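(* Let $\mathscr{H}(\Omega_1)$ and $\mathscr{H}(\Omega_2)$ be functional Hilbert spaces and let $\mathbf{T}=\begin{bmatrix} A & B\\ C & D\end{bmatrix}$ be a bounded linear operator on $\mathscr{H}(\Omega_1)\oplus\mathscr{H}(\Omega_2)$. Then $$\mathbf{ber}(\mathbf{T})\leqslant \frac12\left(\mathbf{ber}(A)+\mathbf{ber}(D)\right)+\frac12\sqrt{\left(\mathbf{ber}(A)-\mathbf{ber}(D)\right)^2+(\|B\|+\|C\|)^2}.$$ In particular, if $\mathbf{T}=\begin{bmatrix} A & 0\\ 0 & D\end{bmatrix}$, then $$\mathbf{ber}(\mathbf{T})\leqslant \max\{\mathbf{ber}(A),\mathbf{ber}(D)\}.$$
   Context: A functional Hilbert space $\mathscr{H}(\Omega)$ is a complex Hilbert space of complex-valued functions on a non-empty set $\Omega$ such that for each $\lambda\in\Omega$ the evaluation $f\mapsto f(\lambda)$ is a continuous linear functional. The reproducing kernel $k_\lambda\in\mathscr{H}(\Omega)$ is the unique element with $f(\lambda)=\langle f,k_\lambda\rangle$ for all $f$. It is assumed that $k_\lambda\neq 0$ for all $\lambda\in\Omega$, and $\hat{k}_\lambda=k_\lambda/\|k_\lambda\|$ is the normalized reproducing kernel. For a bounded linear operator $A$ on $\mathscr{H}(\Omega)$, the Berezin number is $\mathbf{ber}(A)=\sup_{\lambda\in\Omega}|\langle A\hat{k}_\lambda,\hat{k}_\lambda\rangle|$. For a bounded operator $\mathbf{T}$ on $\mathscr{H}(\Omega_1)\oplus\mathscr{H}(\Omega_2)$,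 points are indexed by $(\lambda_1,\lambda_2)\in\Omega_1\times\Omega_2$, and the normalized reproducing kernel at $(\lambda_1,\lambda_2)$ is the unit vector $\mathbf{\hat{k}}_{(\lambda_1,\lambda_2)}$ obtained by normalizing the column vector $(k_{\lambda_1},k_{\lambda_2})$, i.e. dividing it by $(\|k_{\lambda_1}\|^2+\|k_{\lambda_2}\|^2)^{1/2}$. Then $\mathbf{ber}(\mathbf{T})=\sup_{(\lambda_1,\lambda_2)\in\Omega_1\times\Omega_2}|\langle \mathbf{T}\mathbf{\hat{k}}_{(\lambda_1,\lambda_2)},\mathbf{\hat{k}}_{(\lambda_1,\lambda_2)}\rangle|$. In the operator matrix, $A$ acts on $\mathscr{H}(\Omega_1)$, $B$ maps $\mathscr{H}(\Omega_2)$ to $\mathscr{H}(\Omega_1)$, $C$ maps $\mathscr{H}(\Omega_1)$ to $\mathscr{H}(\Omega_2)$, and $D$ acts on $\mathscr{H}(\Omega_2)$; all are bounded. $\|\cdot\|$ is the operator norm. *)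

theory Defs
  imports "HOL-Analysis.Analysis"
begin

text \<open>Complex inner product spaces. The inner product is linear in the first argument, so
  that \<open>f(\<lambda>) = \<langle>f, k\<^sub>\<lambda>\<rangle>\<close> is linear in \<open>f\<close>. Its real part is the real inner product of
  the underlying real space; hence positive definiteness and \<open>\<parallel>x\<parallel>\<^sup>2 = \<langle>x, x\<rangle>\<close> come from the class
  \<^class>\<open>real_inner\<close>.\<close>

class complex_inner = real_inner +
  fixes scaleC :: "complex \<Rightarrow> 'a \<Rightarrow> 'a" (infixr \<open>*\<^sub>C\<close> 75)
    and cinner :: "'a \<Rightarrow> 'a \<Rightarrow> complex"
  assumes scaleC_add_right: "a *\<^sub>C (x + y) = a *\<^sub>C x + a *\<^sub>C y"
    and scaleC_add_left: "(a + b) *\<^sub>C x = a *\<^sub>C x + b *\<^sub>C x"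
    and scaleC_scaleC: "a *\<^sub>C b *\<^sub>C x = (a * b) *\<^sub>C x"
    and scaleC_of_real: "complex_of_real r *\<^sub>C x = r *\<^sub>R x"
    and cinner_commute: "cinner x y = cnj (cinner y x)"
    and cinner_add_left: "cinner (x + y) z = cinner x z + cinner y z"
    and cinner_scaleC_left: "cinner (a *\<^sub>C x) y = a * cinner x y"
    and Re_cinner: "Re (cinner x y) = inner x y"

lemma cinner_self: "cinner x x = complex_of_real ((norm x)\<^sup>2)"
proof (rule complex_eqI)
  show "Re (cinner x x) = Re (complex_of_real ((norm x)\<^sup>2))"
    by (simp add: Re_cinner power2_norm_eq_inner)
  have "Im (cinner x x) = - Im (cinner x x)"
    using arg_cong[OF cinner_commute[of x x], of Im] by (simp only: cnj.sel)
  then show "Im (cinner x x) = Im (complex_of_real ((norm x)\<^sup>2))"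
    by simp
qed

class complex_hilbert = complex_inner + complete_space

instantiation prod :: (complex_inner, complex_inner) complex_inner
begin

definition scaleC_prod :: "complex \<Rightarrow> 'a \<times> 'b \<Rightarrow> 'a \<times> 'b"
  where "scaleC_prod c x = (c *\<^sub>C fst x, c *\<^sub>C snd x)"

definition cinner_prod :: "'a \<times> 'b \<Rightarrow> 'a \<times> 'b \<Rightarrow> complex"
  where "cinner_prod x y = cinner (fst x) (fst y) + cinner (snd x) (snd y)"

instance
proof
  fix x y z :: "'a \<times> 'b"
  show "cinner x y = cnj (cinner y x)"
    unfolding cinner_prod_def complex_cnj_add
    by (intro arg_cong2[where f = plus] cinner_commute)
qed (simp_all add: scaleC_prod_def cinner_prod_def scaleC_add_right scaleC_add_left
      scaleC_scaleC scaleC_of_real cinner_add_left cinner_scaleC_left Re_cinner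
      inner_prod_def distrib_left scaleR_prod_def)

end

instance prod :: (complex_hilbert, complex_hilbert) complex_hilbert ..

text \<open>Bounded operators between complex Hilbert spaces; their norm is \<^const>\<open>onorm\<close>.\<close>

definition bounded_clinear :: "('a::complex_inner \<Rightarrow> 'b::complex_inner) \<Rightarrow> bool"
  where "bounded_clinear T \<longleftrightarrow> bounded_linear T \<and> (\<forall>c x. T (c *\<^sub>C x) = c *\<^sub>C T x)"

definition op_matrix ::
  "('a \<Rightarrow> 'a) \<Rightarrow> ('b \<Rightarrow> 'a) \<Rightarrow> ('a \<Rightarrow> 'b) \<Rightarrow> ('b \<Rightarrow> 'b) \<Rightarrow> 'a \<times> 'b \<Rightarrow> 'a::complex_inner \<times> 'b::complex_inner"
  where "op_matrix A B C D = (\<lambda>(f, g). (A f + B g, C f + D g))"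

text \<open>A functional Hilbert space on \<open>\<Omega>\<close>: the type \<open>'h\<close> carries the Hilbert space, and \<open>ev f x\<close>
  is the value \<open>f(x)\<close>. The elements of \<open>'h\<close> are functions on \<open>\<Omega>\<close> in the sense that they are
  determined by their values on \<open>\<Omega>\<close> and that the vector space operations are pointwise.
  Values of \<open>ev f\<close> outside \<open>\<Omega>\<close> are irrelevant.\<close>

locale functional_hilbert_space =
  fixes \<Omega> :: "'x set"
    and ev :: "'h::complex_hilbert \<Rightarrow> 'x \<Rightarrow> complex"
  assumes nonempty: "\<Omega> \<noteq> {}"
    and ev_eqI: "(\<And>x. x \<in> \<Omega> \<Longrightarrow> ev f x = ev g x) \<Longrightarrow> f = g"
    and ev_add: "x \<in> \<Omega> \<Longrightarrow> ev (f + g) x = ev f x + ev g x"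
    and ev_scaleC: "x \<in> \<Omega> \<Longrightarrow> ev (c *\<^sub>C f) x = c * ev f x"
    and ev_continuous: "x \<in> \<Omega> \<Longrightarrow> continuous_on UNIV (\<lambda>f. ev f x)"

definition rep_kernel :: "('h::complex_hilbert \<Rightarrow> 'x \<Rightarrow> complex) \<Rightarrow> 'x \<Rightarrow> 'h"
  where "rep_kernel ev x = (THE k. \<forall>f. ev f x = cinner f k)"

definition normalized_kernel :: "('h::complex_hilbert \<Rightarrow> 'x \<Rightarrow> complex) \<Rightarrow> 'x \<Rightarrow> 'h"
  where "normalized_kernel ev x = rep_kernel ev x /\<^sub>R norm (rep_kernel ev x)"

definition berezin_number ::
  "'x set \<Rightarrow> ('h::complex_hilbert \<Rightarrow> 'x \<Rightarrow> complex) \<Rightarrow> ('h \<Rightarrow> 'h) \<Rightarrow> real"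
  where "berezin_number \<Omega> ev A =
    (SUP x\<in>\<Omega>. cmod (cinner (A (normalized_kernel ev x)) (normalized_kernel ev x)))"

definition normalized_kernel_sum ::
  "('h1::complex_hilbert \<Rightarrow> 'x1 \<Rightarrow> complex) \<Rightarrow> ('h2::complex_hilbert \<Rightarrow> 'x2 \<Rightarrow> complex) \<Rightarrow>
    'x1 \<times> 'x2 \<Rightarrow> 'h1 \<times> 'h2"
  where "normalized_kernel_sum ev1 ev2 = (\<lambda>(x, y).
    (rep_kernel ev1 x, rep_kernel ev2 y)
      /\<^sub>R sqrt ((norm (rep_kernel ev1 x))\<^sup>2 + (norm (rep_kernel ev2 y))\<^sup>2))"

definition berezin_number_sum ::
  "'x1 set \<Rightarrow> ('h1::complex_hilbert \<Rightarrow> 'x1 \<Rightarrow> complex) \<Rightarrow>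
   'x2 set \<Rightarrow> ('h2::complex_hilbert \<Rightarrow> 'x2 \<Rightarrow> complex) \<Rightarrow> ('h1 \<times> 'h2 \<Rightarrow> 'h1 \<times> 'h2) \<Rightarrow> real"
  where "berezin_number_sum \<Omega>1 ev1 \<Omega>2 ev2 T =
    (SUP p\<in>\<Omega>1 \<times> \<Omega>2.
      cmod (cinner (T (normalized_kernel_sum ev1 ev2 p)) (normalized_kernel_sum ev1 ev2 p)))"

end

theory Submission
  imports Defs
begin

text \<open>The normalized kernel at \<open>(x, y)\<close> is \<open>(s u, t v)\<close>, where \<open>u\<close> and \<open>v\<close> are the normalized
  kernels at \<open>x\<close> and \<open>y\<close> and \<open>s, t \<ge> 0\<close> satisfy \<open>s\<^sup>2 + t\<^sup>2 = 1\<close>. The quadratic form of the operator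
  matrix at this vector is at most \<open>s\<^sup>2 ber(A) + t\<^sup>2 ber(D) + s t (\<parallel>B\<parallel> + \<parallel>C\<parallel>)\<close>, a quadratic form at a
  unit vector of the plane, hence at most its largest eigenvalue. For \<open>B = C = 0\<close> that eigenvalue
  is \<open>max (ber(A)) (ber(D))\<close>.\<close>

lemma cinner_scaleR_left: "cinner (r *\<^sub>R x) y = complex_of_real r * cinner x y"
  by (simp flip: scaleC_of_real add: cinner_scaleC_left)

lemma cinner_scaleR_right: "cinner x (r *\<^sub>R y) = complex_of_real r * cinner x y"
  by (subst (1 2) cinner_commute) (simp add: cinner_scaleR_left)

text \<open>The norm comes from the real inner product, so its behaviour under complex scalars has
  to be derived: conjugate symmetry pulls the second \<open>c\<close> out as \<open>cnj c\<close>,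
  and \<open>c * cnj c\<close> is the square of the modulus.\<close>

lemma norm_scaleC: "norm (c *\<^sub>C x) = cmod c * norm x"
proof -
  have "cinner (c *\<^sub>C x) (c *\<^sub>C x) = c * cnj (c * cinner x x)"
    by (simp only: cinner_scaleC_left cinner_commute[of x "c *\<^sub>C x"])
  also have "\<dots> = complex_of_real ((cmod c)\<^sup>2) * complex_of_real ((norm x)\<^sup>2)"
    by (simp only: cinner_self complex_norm_square complex_cnj_mult complex_cnj_complex_of_real mult.assoc)
  finally have "complex_of_real ((norm (c *\<^sub>C x))\<^sup>2) = complex_of_real ((cmod c * norm x)\<^sup>2)"
    by (simp only: cinner_self of_real_mult[symmetric] power_mult_distrib)
  then have "(norm (c *\<^sub>C x))\<^sup>2 = (cmod c * norm x)\<^sup>2"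
    by (simp only: of_real_eq_iff)
  then show ?thesis
    by simp
qed

text \<open>Complex Cauchy-Schwarz reduces to the real one after a rotation of \<open>x\<close> that
  makes the inner product real and nonnegative.\<close>

lemma norm_cinner_le: "cmod (cinner x y) \<le> norm x * norm y"
proof (cases "cinner x y = 0")
  case False
  \<comment> \<open>The inverse phase of \<open>cinner x y\<close>; it has modulus 1, so the
    rotation preserves the norm of \<open>x\<close>.\<close>
  define c where "c = cnj (cinner x y) / cmod (cinner x y)"
  have "cmod c = 1"
    using False by (simp add: c_def norm_divide)
  have "c * cinner x y = cinner x y * cnj (cinner x y) / cmod (cinner x y)"
    by (simp add: c_def)
  also have "\<dots> = complex_of_real (cmod (cinner x y))"
    unfolding complex_norm_square[symmetric] by (simp add: power2_eq_square)
  finally have "cmod (cinner x y) = Re (c * cinner x y)"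
    by simp
  also have "\<dots> = inner (c *\<^sub>C x) y"
    by (simp add: cinner_scaleC_left flip: Re_cinner)
  also have "\<dots> \<le> norm (c *\<^sub>C x) * norm y"
    by (rule norm_cauchy_schwarz)
  finally show ?thesis
    using \<open>cmod c = 1\<close> by (simp add: norm_scaleC)
qed simp

lemma norm_cinner_le_onorm:
  assumes "bounded_clinear T"
  shows "cmod (cinner (T x) y) \<le> onorm T * norm x * norm y"
proof -
  have "norm (T x) \<le> onorm T * norm x"
    using assms by (simp add: bounded_clinear_def onorm)
  then show ?thesis
    by (meson norm_cinner_le mult_right_mono norm_ge_zero order_trans)
qed

text \<open>Makes the diagonal operator matrix an instance of the general bound.\<close>

lemma bounded_clinear_zero: "bounded_clinear (\<lambda>_ :: 'a::complex_inner. 0 :: 'b::complex_inner)"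
proof -
  have "c *\<^sub>C 0 = (0 :: 'b)" for c
    using scaleC_add_right[of c 0 "0 :: 'b"] by simp
  then show ?thesis
    by (simp add: bounded_clinear_def)
qed

lemma norm_normalized_kernel:
  "rep_kernel ev x \<noteq> 0 \<Longrightarrow> norm (normalized_kernel ev x) = 1"
  by (simp add: normalized_kernel_def)

text \<open>A real supremum dominates its members only if they are bounded above; here
  \<open>onorm A\<close> is a bound, since normalized kernels are unit vectors.\<close>

lemma berezin_number_upper:
  assumes "bounded_clinear A" and "\<And>x. x \<in> \<Omega> \<Longrightarrow> rep_kernel ev x \<noteq> 0" and "x \<in> \<Omega>"
  shows "cmod (cinner (A (normalized_kernel ev x)) (normalized_kernel ev x)) \<le> berezin_number \<Omega> ev A"
  unfolding berezin_number_def
proof (rule cSUP_upper[OF \<open>x \<in> \<Omega>\<close>])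
  show "bdd_above ((\<lambda>x. cmod (cinner (A (normalized_kernel ev x)) (normalized_kernel ev x))) ` \<Omega>)"
  proof (rule bdd_aboveI2)
    fix x assume "x \<in> \<Omega>"
    then show "cmod (cinner (A (normalized_kernel ev x)) (normalized_kernel ev x)) \<le> onorm A"
      using norm_cinner_le_onorm[OF assms(1), of "normalized_kernel ev x" "normalized_kernel ev x"]
      by (simp add: norm_normalized_kernel assms(2))
  qed
qed

lemma normalized_kernel_sum_eq:
  assumes "rep_kernel ev1 x \<noteq> 0" and "rep_kernel ev2 y \<noteq> 0"
  obtains s t where "s \<ge> 0" and "t \<ge> 0" and "s\<^sup>2 + t\<^sup>2 = 1"
    and "normalized_kernel_sum ev1 ev2 (x, y) =
      (s *\<^sub>R normalized_kernel ev1 x, t *\<^sub>R normalized_kernel ev2 y)"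
proof
  \<comment> \<open>Writing each kernel as its norm times its normalization gives the weights s =
    \<open>?a / ?n\<close> and t = \<open>?b / ?n\<close>.\<close>
  let ?a = "norm (rep_kernel ev1 x)" and ?b = "norm (rep_kernel ev2 y)"
  let ?n = "sqrt (?a\<^sup>2 + ?b\<^sup>2)"
  show "?a / ?n \<ge> 0" and "?b / ?n \<ge> 0"
    by simp_all
  have "?a\<^sup>2 + ?b\<^sup>2 > 0"
    using assms by (simp add: sum_power2_gt_zero_iff)
  then have "?a\<^sup>2 + ?b\<^sup>2 \<noteq> 0"
    by (rule less_imp_neq[symmetric])
  then show "(?a / ?n)\<^sup>2 + (?b / ?n)\<^sup>2 = 1"
    by (simp add: power_divide del: sum_power2_eq_zero_iff flip: add_divide_distrib)
  show "normalized_kernel_sum ev1 ev2 (x, y) =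
      ((?a / ?n) *\<^sub>R normalized_kernel ev1 x, (?b / ?n) *\<^sub>R normalized_kernel ev2 y)"
    using assms by (simp add: normalized_kernel_sum_def normalized_kernel_def divide_inverse)
qed

text \<open>The right-hand side is the larger eigenvalue of the symmetric matrix with diagonal
  \<alpha>, \<delta> and off-diagonal entries \<beta>/2.\<close>

lemma quadratic_form_le_eigenvalue:
  fixes \<alpha> \<delta> \<beta> s t :: real
  assumes "s\<^sup>2 + t\<^sup>2 = 1"
  shows "s\<^sup>2 * \<alpha> + t\<^sup>2 * \<delta> + s * t * \<beta> \<le> 1 / 2 * (\<alpha> + \<delta>) + 1 / 2 * sqrt ((\<alpha> - \<delta>)\<^sup>2 + \<beta>\<^sup>2)"
proof -
  \<comment> \<open>With s and t the cosine and sine of an angle, (p, q) is the vector (\<alpha> -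
    \<delta>, \<beta>) rotated clockwise by twice that angle. Its length is unchanged, and p cannot
    exceed it.\<close>
  define p q where "p = (s\<^sup>2 - t\<^sup>2) * (\<alpha> - \<delta>) + 2 * s * t * \<beta>"
    and "q = (s\<^sup>2 - t\<^sup>2) * \<beta> - 2 * s * t * (\<alpha> - \<delta>)"
  have "p\<^sup>2 + q\<^sup>2 = (s\<^sup>2 + t\<^sup>2)\<^sup>2 * ((\<alpha> - \<delta>)\<^sup>2 + \<beta>\<^sup>2)"
    unfolding p_def q_def by algebra
  then have "p\<^sup>2 + q\<^sup>2 = (\<alpha> - \<delta>)\<^sup>2 + \<beta>\<^sup>2"
    by (simp add: assms)
  then have "p \<le> sqrt ((\<alpha> - \<delta>)\<^sup>2 + \<beta>\<^sup>2)"
    by (metis le_add_same_cancel1 real_le_rsqrt zero_le_power2)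
  moreover have "2 * (s\<^sup>2 * \<alpha> + t\<^sup>2 * \<delta> + s * t * \<beta>) = (s\<^sup>2 + t\<^sup>2) * (\<alpha> + \<delta>) + p"
    unfolding p_def by algebra
  ultimately show ?thesis
    using assms by (simp add: add_divide_distrib)
qed

text \<open>The diagonal terms stay as they are, to be compared with Berezin numbers later. The
  off-diagonal terms pair vectors from different spaces, so they are estimated by Cauchy-Schwarz and
  operator norms.\<close>

lemma norm_cinner_op_matrix_le:
  assumes "bounded_clinear A" and B: "bounded_clinear B"
    and C: "bounded_clinear C" and "bounded_clinear D"
    and "s \<ge> 0" and "t \<ge> 0" and "norm u = 1" and "norm v = 1"
  shows "cmod (cinner (op_matrix A B C D (s *\<^sub>R u, t *\<^sub>R v)) (s *\<^sub>R u, t *\<^sub>R v))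
    \<le> s\<^sup>2 * cmod (cinner (A u) u) + t\<^sup>2 * cmod (cinner (D v) v) + s * t * (onorm B + onorm C)"
proof -
  have scale: "T (r *\<^sub>R x) = r *\<^sub>R T x" if "bounded_clinear T"
    for T :: "'c::complex_inner \<Rightarrow> 'd::complex_inner" and r x
    using that by (simp add: bounded_clinear_def linear_simps)
  have "cinner (op_matrix A B C D (s *\<^sub>R u, t *\<^sub>R v)) (s *\<^sub>R u, t *\<^sub>R v)
      = complex_of_real (s\<^sup>2) * cinner (A u) u + complex_of_real (s * t) * cinner (B v) u
        + (complex_of_real (s * t) * cinner (C u) v + complex_of_real (t\<^sup>2) * cinner (D v) v)"
    using assms(1-4)
    by (simp add: op_matrix_def cinner_prod_def scale cinner_add_left cinner_scaleR_left
        cinner_scaleR_right power2_eq_square algebra_simps)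
  also have "cmod \<dots> \<le> s\<^sup>2 * cmod (cinner (A u) u) + s * t * cmod (cinner (B v) u)
        + (s * t * cmod (cinner (C u) v) + t\<^sup>2 * cmod (cinner (D v) v))"
    using assms(5,6) by (intro norm_triangle_mono) (simp_all add: norm_mult norm_power)
  also have "\<dots> \<le> s\<^sup>2 * cmod (cinner (A u) u) + s * t * onorm B
        + (s * t * onorm C + t\<^sup>2 * cmod (cinner (D v) v))"
    using norm_cinner_le_onorm[OF B, of v u] norm_cinner_le_onorm[OF C, of u v] assms(5-8)
    by (intro add_mono mult_left_mono) auto
  finally show ?thesis
    by (simp add: algebra_simps)
qed

lemma berezin_number_sum_le:
  assumes "\<Omega>1 \<noteq> {}" and "\<Omega>2 \<noteq> {}"
    and nz1: "\<And>x. x \<in> \<Omega>1 \<Longrightarrow> rep_kernel ev1 x \<noteq> 0"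
    and nz2: "\<And>x. x \<in> \<Omega>2 \<Longrightarrow> rep_kernel ev2 x \<noteq> 0"
    and A: "bounded_clinear A" and B: "bounded_clinear B"
    and C: "bounded_clinear C" and D: "bounded_clinear D"
  shows "berezin_number_sum \<Omega>1 ev1 \<Omega>2 ev2 (op_matrix A B C D)
      \<le> 1 / 2 * (berezin_number \<Omega>1 ev1 A + berezin_number \<Omega>2 ev2 D)
        + 1 / 2 * sqrt ((berezin_number \<Omega>1 ev1 A - berezin_number \<Omega>2 ev2 D)\<^sup>2
                        + (onorm B + onorm C)\<^sup>2)"
  unfolding berezin_number_sum_def
proof (rule cSUP_least)
  show "\<Omega>1 \<times> \<Omega>2 \<noteq> {}"
    using assms(1,2) by simp
next
  fix p assume "p \<in> \<Omega>1 \<times> \<Omega>2"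
  then obtain x y where p: "p = (x, y)" and x: "x \<in> \<Omega>1" and y: "y \<in> \<Omega>2"
    by blast
  let ?u = "normalized_kernel ev1 x" and ?v = "normalized_kernel ev2 y"
  let ?\<alpha> = "berezin_number \<Omega>1 ev1 A" and ?\<delta> = "berezin_number \<Omega>2 ev2 D"
  obtain s t where st: "s \<ge> 0" "t \<ge> 0" "s\<^sup>2 + t\<^sup>2 = 1"
    and k: "normalized_kernel_sum ev1 ev2 p = (s *\<^sub>R ?u, t *\<^sub>R ?v)"
    unfolding p using nz1[OF x] nz2[OF y] by (rule normalized_kernel_sum_eq)
  have "cmod (cinner (op_matrix A B C D (normalized_kernel_sum ev1 ev2 p))
      (normalized_kernel_sum ev1 ev2 p))
      \<le> s\<^sup>2 * cmod (cinner (A ?u) ?u) + t\<^sup>2 * cmod (cinner (D ?v) ?v) + s * t * (onorm B + onorm C)"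
    unfolding k using A B C D st(1,2)
    by (rule norm_cinner_op_matrix_le) (simp_all add: norm_normalized_kernel nz1 nz2 x y)
  \<comment> \<open>Passing to the suprema leaves only s and t dependent on the point; the
    eigenvalue bound then removes these too.\<close>
  also have "\<dots> \<le> s\<^sup>2 * ?\<alpha> + t\<^sup>2 * ?\<delta> + s * t * (onorm B + onorm C)"
    by (intro add_mono mult_left_mono order_refl berezin_number_upper A D nz1 nz2 x y) simp_all
  also have "\<dots> \<le> 1 / 2 * (?\<alpha> + ?\<delta>) + 1 / 2 * sqrt ((?\<alpha> - ?\<delta>)\<^sup>2 + (onorm B + onorm C)\<^sup>2)"
    using st(3) by (rule quadratic_form_le_eigenvalue)
  finally show "cmod (cinner (op_matrix A B C D (normalized_kernel_sum ev1 ev2 p))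
      (normalized_kernel_sum ev1 ev2 p))
      \<le> 1 / 2 * (?\<alpha> + ?\<delta>) + 1 / 2 * sqrt ((?\<alpha> - ?\<delta>)\<^sup>2 + (onorm B + onorm C)\<^sup>2)" .
qed

theorem corollary2p2:
  fixes \<Omega>1 :: "'x1 set" and ev1 :: "'h1::complex_hilbert \<Rightarrow> 'x1 \<Rightarrow> complex"
    and \<Omega>2 :: "'x2 set" and ev2 :: "'h2::complex_hilbert \<Rightarrow> 'x2 \<Rightarrow> complex"
    and A :: "'h1 \<Rightarrow> 'h1" and B :: "'h2 \<Rightarrow> 'h1" and C :: "'h1 \<Rightarrow> 'h2" and D :: "'h2 \<Rightarrow> 'h2"
  assumes "functional_hilbert_space \<Omega>1 ev1" and "functional_hilbert_space \<Omega>2 ev2"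
    and "\<And>x. x \<in> \<Omega>1 \<Longrightarrow> rep_kernel ev1 x \<noteq> 0"
    and "\<And>x. x \<in> \<Omega>2 \<Longrightarrow> rep_kernel ev2 x \<noteq> 0"
    and "bounded_clinear A" and "bounded_clinear B"
    and "bounded_clinear C" and "bounded_clinear D"
  shows "berezin_number_sum \<Omega>1 ev1 \<Omega>2 ev2 (op_matrix A B C D)
      \<le> 1 / 2 * (berezin_number \<Omega>1 ev1 A + berezin_number \<Omega>2 ev2 D)
        + 1 / 2 * sqrt ((berezin_number \<Omega>1 ev1 A - berezin_number \<Omega>2 ev2 D)\<^sup>2
                        + (onorm B + onorm C)\<^sup>2)
    \<and> berezin_number_sum \<Omega>1 ev1 \<Omega>2 ev2 (op_matrix A (\<lambda>_. 0) (\<lambda>_. 0) D)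
      \<le> max (berezin_number \<Omega>1 ev1 A) (berezin_number \<Omega>2 ev2 D)"
proof
  have ne: "\<Omega>1 \<noteq> {}" "\<Omega>2 \<noteq> {}"
    using assms(1,2) by (simp_all add: functional_hilbert_space.nonempty)
  show "berezin_number_sum \<Omega>1 ev1 \<Omega>2 ev2 (op_matrix A B C D)
      \<le> 1 / 2 * (berezin_number \<Omega>1 ev1 A + berezin_number \<Omega>2 ev2 D)
        + 1 / 2 * sqrt ((berezin_number \<Omega>1 ev1 A - berezin_number \<Omega>2 ev2 D)\<^sup>2
                        + (onorm B + onorm C)\<^sup>2)"
    using ne assms(3-8) by (rule berezin_number_sum_le)
  have "berezin_number_sum \<Omega>1 ev1 \<Omega>2 ev2 (op_matrix A (\<lambda>_. 0) (\<lambda>_. 0) D)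
      \<le> 1 / 2 * (berezin_number \<Omega>1 ev1 A + berezin_number \<Omega>2 ev2 D)
        + 1 / 2 * sqrt ((berezin_number \<Omega>1 ev1 A - berezin_number \<Omega>2 ev2 D)\<^sup>2
                        + (onorm (\<lambda>_::'h2. 0::'h1) + onorm (\<lambda>_::'h1. 0::'h2))\<^sup>2)"
    using ne assms(3-5) bounded_clinear_zero bounded_clinear_zero assms(8)
    by (rule berezin_number_sum_le)
  \<comment> \<open>With both off-diagonal norms zero, the root is the absolute value of the
    difference of the Berezin numbers, and half of sum plus absolute difference is the
    maximum.\<close>
  also have "\<dots> = max (berezin_number \<Omega>1 ev1 A) (berezin_number \<Omega>2 ev2 D)"
    by (auto simp: onorm_zero max_def abs_if add_divide_distrib diff_divide_distrib)
  finally show "berezin_number_sum \<Omega>1 ev1 \<Omega>2 ev2 (op_matrix A (\<lambda>_. 0) (\<lambda>_. 0) D)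
      \<le> max (berezin_number \<Omega>1 ev1 A) (berezin_number \<Omega>2 ev2 D)" .
qed

end
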